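(* An HNS (hereditarily not sensitive) homeomorphism $T:K\to K$ of a compact Hausdorff space has zero topological entropy.
   Context: Let $\mathcal{U}$ be the unique uniformity compatible with the topology of $K$. The system $(K,T)$ is not sensitive if for every entourage $U\in\mathcal{U}$ there is a nonempty open set $O\subseteq K$ such that $(T^ns,T^nt)\in U$ for all $s,t\in O$ and $n\in\mathbb{Z}$. The system $(K,T)$ is HNS (hereditarily not sensitive) if for every nonempty closed set $L\subseteq K$ with $T(L)=L$ the subsystem $(L,T|_L)$ is not sensitive. Topological entropy is the usual one, defined via finite open covers. *)

theory Defs
  imports "HOL-Analysis.Analysis"
begin

section \<open>The uniformity of a compact Hausdorff space\<close>

text \<open>Uniformities in the sense of Bourbaki, as families of entourages. The library class
  \<^class>\<open>uniform_space\<close> ties the uniformity to a type; here it has to live on the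
  carrier of an arbitrary \<^typ>\<open>'a topology\<close>, so that subsystems are again systems.\<close>

definition is_uniformity :: "'a set \<Rightarrow> ('a \<times> 'a) set set \<Rightarrow> bool" where
  "is_uniformity S \<U> \<longleftrightarrow>
     S \<times> S \<in> \<U> \<and>
     (\<forall>U\<in>\<U>. U \<subseteq> S \<times> S \<and> Id_on S \<subseteq> U \<and> U\<inverse> \<in> \<U> \<and> (\<exists>V\<in>\<U>. V O V \<subseteq> U)) \<and>
     (\<forall>U\<in>\<U>. \<forall>V. U \<subseteq> V \<and> V \<subseteq> S \<times> S \<longrightarrow> V \<in> \<U>) \<and>
     (\<forall>U\<in>\<U>. \<forall>V\<in>\<U>. U \<inter> V \<in> \<U>)"

definition compatible_uniformity :: "'a topology \<Rightarrow> ('a \<times> 'a) set set \<Rightarrow> bool" where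
  "compatible_uniformity X \<U> \<longleftrightarrow>
     is_uniformity (topspace X) \<U> \<and>
     (\<forall>A. openin X A \<longleftrightarrow> A \<subseteq> topspace X \<and> (\<forall>x\<in>A. \<exists>U\<in>\<U>. U `` {x} \<subseteq> A))"

text \<open>Meaningful only if there is exactly one compatible uniformity, as is the case for compact
  Hausdorff spaces (lemma \<open>ex1_compatible_uniformity\<close> below).\<close>

definition the_uniformity :: "'a topology \<Rightarrow> ('a \<times> 'a) set set" where
  "the_uniformity X = (THE \<U>. compatible_uniformity X \<U>)"

definition diagonal_neighbourhoods :: "'a topology \<Rightarrow> ('a \<times> 'a) set set" where
  "diagonal_neighbourhoods X =
     {U. U \<subseteq> topspace X \<times> topspace X \<and>
         (\<exists>W. openin (prod_topology X X) W \<and> Id_on (topspace X) \<subseteq> W \<and> W \<subseteq> U)}"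

lemma openin_prod_section:
  assumes "openin (prod_topology X Y) W" "x \<in> topspace X"
  shows "openin Y (W `` {x})"
proof -
  have "continuous_map Y (prod_topology X Y) (\<lambda>y. (x, y))"
    using assms(2) by (intro continuous_map_pairedI) auto
  then have "openin Y {y \<in> topspace Y. (x, y) \<in> W}"
    using assms(1) openin_continuous_map_preimage by fast
  moreover have "{y \<in> topspace Y. (x, y) \<in> W} = W `` {x}"
    using openin_subset[OF assms(1)] by auto
  ultimately show ?thesis by simp
qed

lemma open_square_at_diagonal:
  assumes "openin (prod_topology X X) W" "Id_on (topspace X) \<subseteq> W" "x \<in> topspace X"
  obtains A where "openin X A" "x \<in> A" "A \<times> A \<subseteq> W"
proof -
  have "(x, x) \<in> W" using assms by auto
  then obtain P Q where PQ: "openin X P" "openin X Q" "x \<in> P" "x \<in> Q" "P \<times> Q \<subseteq> W"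
    using assms(1) unfolding openin_prod_topology_alt by meson
  show ?thesis
  proof (rule that[of "P \<inter> Q"])
    show "openin X (P \<inter> Q)" using PQ by blast
    show "x \<in> P \<inter> Q" using PQ by blast
    show "(P \<inter> Q) \<times> (P \<inter> Q) \<subseteq> W" using PQ by blast
  qed
qed

lemma finite_subcover_at_points:
  assumes "compact_space X" "\<And>x. x \<in> topspace X \<Longrightarrow> openin X (B x) \<and> x \<in> B x"
  obtains F where "finite F" "F \<subseteq> topspace X" "topspace X \<subseteq> (\<Union>x\<in>F. B x)"
proof -
  have "\<exists>\<F>. finite \<F> \<and> \<F> \<subseteq> B ` topspace X \<and> topspace X \<subseteq> \<Union>\<F>"
    using assms(1) unfolding compact_space_alt
  proof (elim allE impE)
    show "(\<forall>U\<in>B ` topspace X. openin X U) \<and> topspace X \<subseteq> \<Union> (B ` topspace X)"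
      using assms(2) by auto
  qed auto
  then obtain \<F> where F: "finite \<F>" "\<F> \<subseteq> B ` topspace X" "topspace X \<subseteq> \<Union>\<F>" by blast
  then obtain F where "F \<subseteq> topspace X" "finite F" "\<F> = B ` F"
    using finite_subset_image[OF F(1,2)] by blast
  then show ?thesis using F that by blast
qed

lemma diagonal_neighbourhoods_half:
  assumes X: "compact_space X" "Hausdorff_space X"
    and W: "openin (prod_topology X X) W" "Id_on (topspace X) \<subseteq> W"
  obtains V where "openin (prod_topology X X) V" "Id_on (topspace X) \<subseteq> V" "V O V \<subseteq> W"
proof -
  let ?S = "topspace X"
  have reg: "regular_space X"
    using X compact_Hausdorff_or_regular_imp_normal_space compact_Hausdorff_imp_regular_space
    by blast
  have "\<exists>A B C. openin X A \<and> openin X B \<and> closedin X C \<and> x \<in> B \<and> B \<subseteq> C \<and> C \<subseteq> A \<and> A \<times> A \<subseteq> W"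
    if x: "x \<in> ?S" for x
  proof -
    obtain A where A: "openin X A" "x \<in> A" "A \<times> A \<subseteq> W"
      using open_square_at_diagonal[OF W x] by blast
    then obtain B C where "openin X B" "closedin X C" "x \<in> B" "B \<subseteq> C" "C \<subseteq> A"
      using reg unfolding neighbourhood_base_of_closedin[symmetric] neighbourhood_base_of
      by meson
    with A show ?thesis by blast
  qed
  then obtain A B C where ABC: "\<And>x. x \<in> ?S \<Longrightarrow> openin X (A x) \<and> openin X (B x) \<and> closedin X (C x)
      \<and> x \<in> B x \<and> B x \<subseteq> C x \<and> C x \<subseteq> A x \<and> A x \<times> A x \<subseteq> W"
    by metis
  obtain F where F: "finite F" "F \<subseteq> ?S" "?S \<subseteq> (\<Union>x\<in>F. B x)"
    using finite_subcover_at_points[OF X(1), of B] ABC by blast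
  define E where "E x = A x \<times> A x \<union> (?S - C x) \<times> (?S - C x)" for x
  define V where "V = (?S \<times> ?S) \<inter> (\<Inter>x\<in>F. E x)"
  have E: "openin (prod_topology X X) (E x)" if "x \<in> F" for x
    unfolding E_def using ABC F that
    by (intro openin_Un) (auto simp: openin_prod_Times_iff intro!: openin_diff)
  have SS: "openin (prod_topology X X) (?S \<times> ?S)"
    by (simp add: openin_prod_Times_iff)
  show ?thesis
  proof
    show "openin (prod_topology X X) V"
    proof (cases "F = {}")
      case False
      then show ?thesis unfolding V_def using E SS F(1)
        by (intro openin_Int openin_Inter) auto
    qed (simp add: V_def SS)
    show "Id_on ?S \<subseteq> V"
    proof clarify
      fix y assume y: "y \<in> ?S"
      have "(y, y) \<in> E x" if "x \<in> F" for x
      proof -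
        have "C x \<subseteq> A x" using ABC that F by blast
        with y show ?thesis unfolding E_def by auto
      qed
      with y show "(y, y) \<in> V" unfolding V_def by simp
    qed
    show "V O V \<subseteq> W"
    proof clarify
      fix a b c assume ab: "(a, b) \<in> V" and bc: "(b, c) \<in> V"
      then have b: "b \<in> ?S" unfolding V_def by blast
      then obtain x where x: "x \<in> F" "b \<in> B x" using F(3) by blast
      have xS: "x \<in> ?S" using F(2) x(1) by blast
      have "b \<in> C x" using ABC[OF xS] x(2) by blast
      moreover have "(a, b) \<in> E x" "(b, c) \<in> E x" using ab bc x(1) unfolding V_def by blast+
      ultimately have "a \<in> A x" "c \<in> A x" unfolding E_def by blast+
      then show "(a, c) \<in> W" using ABC[OF xS] by blast
    qed
  qed
qed

lemma compatible_diagonal_neighbourhoods: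
  assumes X: "compact_space X" "Hausdorff_space X"
  shows "compatible_uniformity X (diagonal_neighbourhoods X)"
proof -
  let ?S = "topspace X" and ?N = "diagonal_neighbourhoods X"
  have SS: "openin (prod_topology X X) (?S \<times> ?S)"
    by (simp add: openin_prod_Times_iff)
  have "U\<inverse> \<in> ?N" if U: "U \<in> ?N" for U
  proof -
    obtain W where W: "openin (prod_topology X X) W" "Id_on ?S \<subseteq> W" "W \<subseteq> U" "U \<subseteq> ?S \<times> ?S"
      using U unfolding diagonal_neighbourhoods_def by blast
    have "continuous_map (prod_topology X X) (prod_topology X X) (\<lambda>p. (snd p, fst p))"
      by (intro continuous_map_pairedI continuous_map_fst continuous_map_snd)
    then have "openin (prod_topology X X) {p \<in> topspace (prod_topology X X). (snd p, fst p) \<in> W}"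
      using W(1) openin_continuous_map_preimage by fast
    moreover have "{p \<in> topspace (prod_topology X X). (snd p, fst p) \<in> W} = W\<inverse>"
      using W(3,4) by auto
    ultimately have "openin (prod_topology X X) (W\<inverse>)" by simp
    then show ?thesis using W unfolding diagonal_neighbourhoods_def by blast
  qed
  moreover have "\<exists>V\<in>?N. V O V \<subseteq> U" if U: "U \<in> ?N" for U
  proof -
    obtain W where W: "openin (prod_topology X X) W" "Id_on ?S \<subseteq> W" "W \<subseteq> U"
      using U unfolding diagonal_neighbourhoods_def by blast
    then obtain V where "openin (prod_topology X X) V" "Id_on ?S \<subseteq> V" "V O V \<subseteq> W"
      using diagonal_neighbourhoods_half[OF X] by blast
    moreover then have "V \<in> ?N"
      using openin_subset unfolding diagonal_neighbourhoods_def by fastforce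
    ultimately show ?thesis using W by blast
  qed
  moreover have "U \<inter> V \<in> ?N" if UV: "U \<in> ?N" "V \<in> ?N" for U V
  proof -
    obtain W where "openin (prod_topology X X) W" "Id_on ?S \<subseteq> W" "W \<subseteq> U"
      using UV(1) unfolding diagonal_neighbourhoods_def by blast
    moreover obtain W' where "openin (prod_topology X X) W'" "Id_on ?S \<subseteq> W'" "W' \<subseteq> V"
      using UV(2) unfolding diagonal_neighbourhoods_def by blast
    ultimately have "openin (prod_topology X X) (W \<inter> W')" "Id_on ?S \<subseteq> W \<inter> W'" "W \<inter> W' \<subseteq> U \<inter> V"
      by auto
    then show ?thesis using UV unfolding diagonal_neighbourhoods_def by blast
  qed
  moreover have "?S \<times> ?S \<in> ?N"
    using SS unfolding diagonal_neighbourhoods_def by auto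
  moreover have "U \<subseteq> ?S \<times> ?S" "Id_on ?S \<subseteq> U" if "U \<in> ?N" for U
    using that unfolding diagonal_neighbourhoods_def by blast+
  moreover have "V \<in> ?N" if "U \<in> ?N" "U \<subseteq> V" "V \<subseteq> ?S \<times> ?S" for U V
    using that unfolding diagonal_neighbourhoods_def by blast
  ultimately have uniform: "is_uniformity ?S ?N"
    unfolding is_uniformity_def by simp
  have topology: "openin X A \<longleftrightarrow> A \<subseteq> ?S \<and> (\<forall>x\<in>A. \<exists>U\<in>?N. U `` {x} \<subseteq> A)" for A
  proof safe
    fix x assume "openin X A" "x \<in> A"
    then have x: "x \<in> ?S" and A: "A \<subseteq> ?S" using openin_subset by auto
    have "closedin X {x}"
      using X(2) x by (simp add: closedin_Hausdorff_singleton)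
    then have "openin (prod_topology X X) (A \<times> A \<union> (?S - {x}) \<times> (?S - {x}))"
      using \<open>openin X A\<close> by (intro openin_Un) (auto simp: openin_prod_Times_iff)
    moreover have "A \<times> A \<union> (?S - {x}) \<times> (?S - {x}) \<subseteq> ?S \<times> ?S" using A by blast
    moreover have "Id_on ?S \<subseteq> A \<times> A \<union> (?S - {x}) \<times> (?S - {x})" using \<open>x \<in> A\<close> by auto
    ultimately have "A \<times> A \<union> (?S - {x}) \<times> (?S - {x}) \<in> ?N"
      unfolding diagonal_neighbourhoods_def by blast
    then show "\<exists>U\<in>?N. U `` {x} \<subseteq> A" by (rule bexI[rotated]) auto
  next
    fix x assume "openin X A" "x \<in> A"
    then show "x \<in> ?S" using openin_subset by auto
  next
    assume A: "A \<subseteq> ?S" and *: "\<forall>x\<in>A. \<exists>U\<in>?N. U `` {x} \<subseteq> A"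
    show "openin X A"
    proof (subst openin_subopen, intro ballI)
      fix x assume x: "x \<in> A"
      then obtain U where "U \<in> ?N" and U: "U `` {x} \<subseteq> A" using * by blast
      then obtain W where W: "openin (prod_topology X X) W" "Id_on ?S \<subseteq> W" "W \<subseteq> U"
        unfolding diagonal_neighbourhoods_def by blast
      moreover have "W `` {x} \<subseteq> A" using U W(3) by blast
      moreover have "x \<in> W `` {x}" using x A W(2) by auto
      moreover have "openin X (W `` {x})"
        using openin_prod_section[OF W(1)] x A by blast
      ultimately show "\<exists>T. openin X T \<and> x \<in> T \<and> T \<subseteq> A" by blast
    qed
  qed
  show ?thesis
    unfolding compatible_uniformity_def
    by (rule conjI[OF uniform], rule allI, rule topology)
qed

lemma is_uniformityD:
  assumes "is_uniformity S \<U>"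
  shows "S \<times> S \<in> \<U>"
    and "U \<in> \<U> \<Longrightarrow> U \<subseteq> S \<times> S"
    and "U \<in> \<U> \<Longrightarrow> Id_on S \<subseteq> U"
    and "U \<in> \<U> \<Longrightarrow> U\<inverse> \<in> \<U>"
    and "U \<in> \<U> \<Longrightarrow> \<exists>V\<in>\<U>. V O V \<subseteq> U"
    and "U \<in> \<U> \<Longrightarrow> U \<subseteq> V \<Longrightarrow> V \<subseteq> S \<times> S \<Longrightarrow> V \<in> \<U>"
    and "U \<in> \<U> \<Longrightarrow> V \<in> \<U> \<Longrightarrow> U \<inter> V \<in> \<U>"
  using assms unfolding is_uniformity_def by meson+

lemma compatible_uniformityD:
  assumes "compatible_uniformity X \<U>"
  shows "is_uniformity (topspace X) \<U>"
    and "openin X A \<longleftrightarrow> A \<subseteq> topspace X \<and> (\<forall>x\<in>A. \<exists>U\<in>\<U>. U `` {x} \<subseteq> A)"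
  using assms unfolding compatible_uniformity_def by simp_all

lemma uniform_interior:
  assumes U: "compatible_uniformity X \<U>" "V \<in> \<U>" "x \<in> topspace X"
  obtains G where "openin X G" "x \<in> G" "G \<subseteq> V `` {x}"
proof -
  let ?S = "topspace X"
  note uni = is_uniformityD[OF compatible_uniformityD(1)[OF U(1)]]
  define G where "G = {y \<in> ?S. \<exists>E\<in>\<U>. E `` {y} \<subseteq> V `` {x}}"
  note refl = uni(3)
  have "\<exists>E\<in>\<U>. E `` {y} \<subseteq> G" if y: "y \<in> G" for y
  proof -
    obtain E where E: "E \<in> \<U>" "E `` {y} \<subseteq> V `` {x}" using y unfolding G_def by blast
    then obtain F where F: "F \<in> \<U>" "F O F \<subseteq> E" using uni(5) by blast
    then have "F \<subseteq> ?S \<times> ?S" using uni(2) by blast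
    moreover have "F `` {z} \<subseteq> V `` {x}" if "(y, z) \<in> F" for z
      using that E F by blast
    ultimately have "F `` {y} \<subseteq> G" using F(1) unfolding G_def by blast
    with F(1) show ?thesis by blast
  qed
  moreover have "G \<subseteq> ?S" unfolding G_def by blast
  ultimately have "openin X G" using compatible_uniformityD(2)[OF U(1)] by simp
  moreover have "x \<in> G" using U unfolding G_def by blast
  moreover have "G \<subseteq> V `` {x}"
  proof
    fix y assume "y \<in> G"
    then obtain E where "E \<in> \<U>" "E `` {y} \<subseteq> V `` {x}" "y \<in> ?S" unfolding G_def by blast
    then show "y \<in> V `` {x}" using refl by blast
  qed
  ultimately show ?thesis using that by blast
qed

lemma compatible_uniformity_unique:
  assumes X: "compact_space X" and U: "compatible_uniformity X \<U>"
  shows "\<U> = diagonal_neighbourhoods X"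
proof
  let ?S = "topspace X" and ?N = "diagonal_neighbourhoods X"
  note uni = is_uniformityD[OF compatible_uniformityD(1)[OF U]]
  note sub = uni(2) and refl = uni(3)
  show "\<U> \<subseteq> ?N"
  proof
    fix E assume E: "E \<in> \<U>"
    then obtain V where V: "V \<in> \<U>" "V O V \<subseteq> E" using uni(5) by blast
    then have V': "V \<inter> V\<inverse> \<in> \<U>" using uni(4,7) by blast
    have "\<exists>H. openin X H \<and> x \<in> H \<and> H \<subseteq> (V \<inter> V\<inverse>) `` {x}" if "x \<in> ?S" for x
      by (rule uniform_interior[OF U V' that]) blast
    then obtain G where G: "\<And>x. x \<in> ?S \<Longrightarrow> openin X (G x) \<and> x \<in> G x \<and> G x \<subseteq> (V \<inter> V\<inverse>) `` {x}"
      by metis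
    have "openin (prod_topology X X) (\<Union>x\<in>?S. G x \<times> G x)"
      using G by (intro openin_Union) (auto simp: openin_prod_Times_iff)
    moreover have "Id_on ?S \<subseteq> (\<Union>x\<in>?S. G x \<times> G x)" using G by blast
    moreover have "(\<Union>x\<in>?S. G x \<times> G x) \<subseteq> E" using G V by blast
    ultimately show "E \<in> ?N" using sub[OF E] unfolding diagonal_neighbourhoods_def by blast
  qed
  show "?N \<subseteq> \<U>"
  proof
    fix E assume "E \<in> ?N"
    then obtain W where W: "openin (prod_topology X X) W" "Id_on ?S \<subseteq> W" "W \<subseteq> E"
      and E: "E \<subseteq> ?S \<times> ?S" unfolding diagonal_neighbourhoods_def by blast
    have "\<exists>A V H. A \<times> A \<subseteq> W \<and> V \<in> \<U> \<and> (V O V) `` {x} \<subseteq> A \<and> openin X H \<and> x \<in> H \<and> H \<subseteq> V `` {x}"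
      if x: "x \<in> ?S" for x
    proof -
      obtain A where A: "openin X A" "x \<in> A" "A \<times> A \<subseteq> W"
        using open_square_at_diagonal[OF W(1,2) x] by blast
      then obtain D where D: "D \<in> \<U>" "D `` {x} \<subseteq> A"
        using compatible_uniformityD(2)[OF U, of A] by blast
      then obtain V where V: "V \<in> \<U>" "V O V \<subseteq> D" using uni(5) by blast
      obtain H where "openin X H" "x \<in> H" "H \<subseteq> V `` {x}"
        using uniform_interior[OF U V(1) x] by blast
      with A D V show ?thesis by blast
    qed
    then obtain A V H where AVH: "\<And>x. x \<in> ?S \<Longrightarrow> A x \<times> A x \<subseteq> W \<and> V x \<in> \<U> \<and>
        (V x O V x) `` {x} \<subseteq> A x \<and> openin X (H x) \<and> x \<in> H x \<and> H x \<subseteq> V x `` {x}"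
      by metis
    obtain F where F: "finite F" "F \<subseteq> ?S" "?S \<subseteq> (\<Union>x\<in>F. H x)"
      using finite_subcover_at_points[OF X, of H] AVH by blast
    have "(?S \<times> ?S) \<inter> (\<Inter>x\<in>F. V x) \<in> \<U>"
      using F(1,2)
    proof (induction F rule: finite_induct)
      case empty
      then show ?case using uni(1) by simp
    next
      case (insert x F)
      then have "?S \<times> ?S \<inter> (\<Inter>x\<in>F. V x) \<in> \<U>" "V x \<in> \<U>" using AVH[of x] by simp_all
      then have "(?S \<times> ?S \<inter> (\<Inter>x\<in>F. V x)) \<inter> V x \<in> \<U>" by (rule uni(7))
      moreover have "(?S \<times> ?S \<inter> (\<Inter>x\<in>F. V x)) \<inter> V x = ?S \<times> ?S \<inter> (\<Inter>x\<in>insert x F. V x)"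
        by blast
      ultimately show ?case by simp
    qed
    moreover have "(?S \<times> ?S) \<inter> (\<Inter>x\<in>F. V x) \<subseteq> E"
    proof clarify
      fix a b assume ab: "a \<in> ?S" "b \<in> ?S" "(a, b) \<in> (\<Inter>x\<in>F. V x)"
      then obtain x where x: "x \<in> F" "a \<in> H x" using F by blast
      then have xS: "x \<in> ?S" using F(2) by blast
      have xa: "(x, a) \<in> V x" using AVH[OF xS] x(2) by blast
      have xb: "(a, b) \<in> V x" using ab(3) x(1) by blast
      have "(a, a) \<in> V x" using refl[of "V x"] AVH[OF xS] ab(1) by blast
      then have "a \<in> A x" "b \<in> A x" using AVH[OF xS] xa xb by blast+
      then show "(a, b) \<in> E" using AVH[OF xS] W(3) by blast
    qed
    ultimately show "E \<in> \<U>" using E uni(6) by blast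
  qed
qed

lemma ex1_compatible_uniformity:
  assumes "compact_space X" "Hausdorff_space X"
  shows "\<exists>!\<U>. compatible_uniformity X \<U>"
  by (rule ex1I, rule compatible_diagonal_neighbourhoods[OF assms])
    (rule compatible_uniformity_unique[OF assms(1)])

lemma the_uniformity_eq:
  assumes "compact_space X" "Hausdorff_space X"
  shows "the_uniformity X = diagonal_neighbourhoods X"
  unfolding the_uniformity_def
  by (rule the_equality, rule compatible_diagonal_neighbourhoods[OF assms])
    (rule compatible_uniformity_unique[OF assms(1)])

section \<open>Sensitivity\<close>

text \<open>The integer iterates of a bijection \<open>T\<close> of \<open>S\<close>; negative powers use the inverse of
  \<open>T\<close> as a map of \<open>S\<close>, so values off \<open>S\<close> are irrelevant.\<close>

definition int_iterate :: "'a set \<Rightarrow> ('a \<Rightarrow> 'a) \<Rightarrow> int \<Rightarrow> 'a \<Rightarrow> 'a" where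
  "int_iterate S T n =
     (if 0 \<le> n then T ^^ nat n else inv_into S T ^^ nat (- n))"

definition not_sensitive :: "'a topology \<Rightarrow> ('a \<Rightarrow> 'a) \<Rightarrow> bool" where
  "not_sensitive X T \<longleftrightarrow>
     (\<forall>U\<in>the_uniformity X. \<exists>G. openin X G \<and> G \<noteq> {} \<and>
        (\<forall>s\<in>G. \<forall>t\<in>G. \<forall>n::int.
           (int_iterate (topspace X) T n s, int_iterate (topspace X) T n t) \<in> U))"

definition HNS :: "'a topology \<Rightarrow> ('a \<Rightarrow> 'a) \<Rightarrow> bool" where
  "HNS X T \<longleftrightarrow>
     (\<forall>L. closedin X L \<and> L \<noteq> {} \<and> T ` L = L \<longrightarrow> not_sensitive (subtopology X L) T)"

section \<open>Topological entropy\<close>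

definition finite_open_cover :: "'a topology \<Rightarrow> 'a set set \<Rightarrow> bool" where
  "finite_open_cover X \<A> \<longleftrightarrow> finite \<A> \<and> (\<forall>A\<in>\<A>. openin X A) \<and> \<Union>\<A> = topspace X"

text \<open>The join of the covers \<open>\<A>, T\<^sup>-\<^sup>1\<A>, \<dots>, T\<^sup>-\<^sup>(\<^sup>n\<^sup>-\<^sup>1\<^sup>)\<A>\<close>; the function \<open>A\<close> selects one
  member from each.\<close>

definition iterated_cover :: "'a topology \<Rightarrow> ('a \<Rightarrow> 'a) \<Rightarrow> 'a set set \<Rightarrow> nat \<Rightarrow> 'a set set" where
  "iterated_cover X T \<A> n =
     {{x \<in> topspace X. \<forall>i<n. (T ^^ i) x \<in> A i} | A :: nat \<Rightarrow> 'a set. \<forall>i<n. A i \<in> \<A>}"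

definition cover_number :: "'a topology \<Rightarrow> 'a set set \<Rightarrow> nat" where
  "cover_number X \<C> = (LEAST k. \<exists>\<D>\<subseteq>\<C>. finite \<D> \<and> card \<D> = k \<and> \<Union>\<D> = topspace X)"

text \<open>For a continuous self-map the limit exists by subadditivity (Fekete). The entropy may be
  infinite, hence \<^typ>\<open>ereal\<close>.\<close>

definition cover_entropy :: "'a topology \<Rightarrow> ('a \<Rightarrow> 'a) \<Rightarrow> 'a set set \<Rightarrow> real" where
  "cover_entropy X T \<A> =
     lim (\<lambda>n. ln (real (cover_number X (iterated_cover X T \<A> n))) / real n)"

definition topological_entropy :: "'a topology \<Rightarrow> ('a \<Rightarrow> 'a) \<Rightarrow> ereal" where
  "topological_entropy X T = (SUP \<A>\<in>Collect (finite_open_cover X). ereal (cover_entropy X T \<A>))"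

end

theory Submission
  imports Defs
begin

text \<open>
  The proof is combinatorial and uses no invariant measures. Given a finite open cover \<open>\<A>\<close>, fix a
  finite closed cover \<open>\<P>\<close> and an entourage \<open>W\<close>, both so fine that the members of any subfamily of
  \<open>\<P>\<close> whose members are pairwise not separated by \<open>W\<close> lie together in a single member of \<open>\<A>\<close>
  (\<open>clusters_of_small_sets\<close>).

  Consider a game in which one follows a set along the orbit. At each time the first player either
  waits or splits the current set by two members of \<open>\<P>\<close> that \<open>W\<close> separates; after a split
  the opponent chooses the half with which the game goes on. Waiting costs one unit of credit, a
  split earns \<open>m\<close> units, so the first player survives as long as the splits have frequency
  about \<open>1 / (m + 1)\<close> at least. Two facts about this game (\<open>survives\<close>) give the theorem.

  If the first player could survive forever, the closed sets for which this is possible from some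
  iterate would form a nonempty family in which every member contains two members whose images
  under one iterate are separated by \<open>W\<close>. A closed set that is minimal among those meeting all
  members of the family then has no nonempty relatively open piece whose orbit stays \<open>W\<close>-small,
  and the closure of its full orbit is a sensitive subsystem
  (\<open>HNS_fragmented\<close>, \<open>HNS_no_splitting_family\<close>). So for an HNS system and each \<open>m\<close> there is a
  bound on the number of rounds that the first player survives (\<open>HNS_loses_splitting_game\<close>).

  If the opponent wins within boundedly many rounds from every set, then at each time
  all cells that remain dangerous fit into one member of \<open>\<A>\<close>. Following the opponent's
  strategy and restarting it whenever it has won, one covers the space by sets whose
  \<open>\<A>\<close>-names are coded by words in which at most about one letter in \<open>m\<close> is free. Their
  number grows at an exponential rate that tends to \<open>0\<close> as \<open>m\<close> grows
  (\<open>coverable_if_game_lost\<close>).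
\<close>

section \<open>Uniform refinement of a finite open cover\<close>

lemma closed_neighbourhood_inside:
  assumes "compact_space X" "Hausdorff_space X" "openin X A" "x \<in> A"
  obtains B C where "openin X B" "closedin X C" "x \<in> B" "B \<subseteq> C" "C \<subseteq> A"
proof -
  have "regular_space X"
    using assms(1,2) compact_Hausdorff_imp_regular_space by blast
  then obtain B C where "openin X B" "closedin X C" "x \<in> B" "B \<subseteq> C" "C \<subseteq> A"
    using assms(3,4) unfolding neighbourhood_base_of_closedin[symmetric] neighbourhood_base_of
    by meson
  then show ?thesis by (rule that)
qed

text \<open>The sets \<open>C z\<close> are closed neighbourhoods inside members \<open>A z\<close> of the cover. The entourage
  \<open>A z \<times> A z \<union> (S - C z) \<times> S\<close> constrains only the pairs whose first point lies in
  \<open>C z\<close>, and forces the second point into \<open>A z\<close>; finitely many \<open>C z\<close> cover the space.\<close>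

lemma Lebesgue_entourage:
  assumes X: "compact_space X" "Hausdorff_space X" and cover: "finite_open_cover X \<A>"
  obtains W where "openin (prod_topology X X) W" "Id_on (topspace X) \<subseteq> W"
    "\<And>x. x \<in> topspace X \<Longrightarrow> \<exists>A\<in>\<A>. W `` {x} \<subseteq> A"
proof -
  let ?S = "topspace X"
  have "\<exists>A B C. A \<in> \<A> \<and> openin X B \<and> closedin X C \<and> x \<in> B \<and> B \<subseteq> C \<and> C \<subseteq> A"
    if x: "x \<in> ?S" for x
  proof -
    obtain A where "A \<in> \<A>" "x \<in> A" "openin X A"
      using cover x unfolding finite_open_cover_def by blast
    moreover obtain B C where "openin X B" "closedin X C" "x \<in> B" "B \<subseteq> C" "C \<subseteq> A"
      using closed_neighbourhood_inside[OF X \<open>openin X A\<close> \<open>x \<in> A\<close>] by blast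
    ultimately show ?thesis by blast
  qed
  then obtain A B C where ABC: "\<And>x. x \<in> ?S \<Longrightarrow> A x \<in> \<A> \<and> openin X (B x) \<and> closedin X (C x)
      \<and> x \<in> B x \<and> B x \<subseteq> C x \<and> C x \<subseteq> A x"
    by metis
  obtain F where F: "finite F" "F \<subseteq> ?S" "?S \<subseteq> (\<Union>x\<in>F. B x)"
    using finite_subcover_at_points[OF X(1), of B] ABC by blast
  define E where "E x = A x \<times> A x \<union> (?S - C x) \<times> ?S" for x
  define W where "W = (?S \<times> ?S) \<inter> (\<Inter>x\<in>F. E x)"
  have E: "openin (prod_topology X X) (E x)" if "x \<in> F" for x
    unfolding E_def using ABC F that cover unfolding finite_open_cover_def
    by (intro openin_Un) (auto simp: openin_prod_Times_iff intro!: openin_diff)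
  show ?thesis
  proof
    show "openin (prod_topology X X) W"
    proof (cases "F = {}")
      case False
      then show ?thesis unfolding W_def using E F(1)
        by (intro openin_Int openin_Inter) (auto simp: openin_prod_Times_iff)
    qed (simp add: W_def openin_prod_Times_iff)
    show "Id_on ?S \<subseteq> W"
    proof clarify
      fix y assume y: "y \<in> ?S"
      have "(y, y) \<in> E x" if "x \<in> F" for x
      proof -
        have "C x \<subseteq> A x" using ABC that F by blast
        with y show ?thesis unfolding E_def by auto
      qed
      with y show "(y, y) \<in> W" unfolding W_def by simp
    qed
    show "\<exists>A\<in>\<A>. W `` {x} \<subseteq> A" if x: "x \<in> ?S" for x
    proof -
      obtain z where z: "z \<in> F" "x \<in> B z" using F(3) x by blast
      have zS: "z \<in> ?S" using F(2) z(1) by blast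
      have "x \<in> C z" using ABC[OF zS] z(2) by blast
      then have "E z `` {x} \<subseteq> A z" unfolding E_def by blast
      moreover have "W \<subseteq> E z" unfolding W_def using z(1) by blast
      ultimately show ?thesis using ABC[OF zS] by blast
    qed
  qed
qed

lemma small_closed_cover:
  assumes X: "compact_space X" "Hausdorff_space X"
    and W: "openin (prod_topology X X) W" "Id_on (topspace X) \<subseteq> W"
  obtains \<P> where "finite \<P>" "\<Union>\<P> = topspace X" "\<And>P. P \<in> \<P> \<Longrightarrow> closedin X P"
    "\<And>P. P \<in> \<P> \<Longrightarrow> P \<times> P \<subseteq> W"
proof -
  let ?S = "topspace X"
  have "\<exists>B C. openin X B \<and> closedin X C \<and> x \<in> B \<and> B \<subseteq> C \<and> C \<times> C \<subseteq> W"
    if x: "x \<in> ?S" for x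
  proof -
    obtain A where A: "openin X A" "x \<in> A" "A \<times> A \<subseteq> W"
      using open_square_at_diagonal[OF W x] by blast
    obtain B C where BC: "openin X B" "closedin X C" "x \<in> B" "B \<subseteq> C" "C \<subseteq> A"
      using closed_neighbourhood_inside[OF X A(1,2)] by blast
    then have "C \<times> C \<subseteq> W" using A(3) by blast
    with BC show ?thesis by blast
  qed
  then obtain B C where BC: "\<And>x. x \<in> ?S \<Longrightarrow> openin X (B x) \<and> closedin X (C x)
      \<and> x \<in> B x \<and> B x \<subseteq> C x \<and> C x \<times> C x \<subseteq> W"
    by metis
  obtain F where F: "finite F" "F \<subseteq> ?S" "?S \<subseteq> (\<Union>x\<in>F. B x)"
    using finite_subcover_at_points[OF X(1), of B] BC by blast
  show ?thesis
  proof (rule that[of "C ` F"])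
    show "finite (C ` F)" using F(1) by simp
    have cl: "closedin X (C x)" "B x \<subseteq> C x" "C x \<times> C x \<subseteq> W" if "x \<in> F" for x
      using BC[of x] F(2) that by auto
    show "\<Union> (C ` F) = ?S"
    proof
      show "\<Union> (C ` F) \<subseteq> ?S" using closedin_subset[OF cl(1)] by blast
      show "?S \<subseteq> \<Union> (C ` F)" using F(3) cl(2) by blast
    qed
    show "closedin X P" "P \<times> P \<subseteq> W" if "P \<in> C ` F" for P
      using that cl by blast+
  qed
qed

text \<open>If the members of \<open>\<Q>\<close> are \<open>W\<close>-small and pairwise not separated by \<open>W\<close>, any point of
  \<open>\<Union>\<Q>\<close> is reached from a fixed point of a fixed member by three steps in \<open>W\<close>. So it suffices that
  \<open>W O W O W\<close> be contained in a Lebesgue entourage of the cover; \<open>W\<close> is obtained from that by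
  halving twice.\<close>

lemma clusters_of_small_sets:
  assumes X: "compact_space X" "Hausdorff_space X" and cover: "finite_open_cover X \<A>"
  obtains \<P> W where "finite \<P>" "\<Union>\<P> = topspace X" "\<And>P. P \<in> \<P> \<Longrightarrow> closedin X P"
    "openin (prod_topology X X) W" "Id_on (topspace X) \<subseteq> W"
    "\<And>\<Q>. \<lbrakk>\<Q> \<subseteq> \<P>; topspace X \<noteq> {}; \<forall>P\<in>\<Q>. \<forall>Q\<in>\<Q>. P \<times> Q \<inter> W \<noteq> {}\<rbrakk>
       \<Longrightarrow> \<exists>A\<in>\<A>. \<Union>\<Q> \<subseteq> A"
proof -
  let ?S = "topspace X"
  obtain W1 where W1: "openin (prod_topology X X) W1" "Id_on ?S \<subseteq> W1"
    "\<And>x. x \<in> ?S \<Longrightarrow> \<exists>A\<in>\<A>. W1 `` {x} \<subseteq> A"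
    using Lebesgue_entourage[OF X cover] by blast
  obtain V where V: "openin (prod_topology X X) V" "Id_on ?S \<subseteq> V" "V O V \<subseteq> W1"
    using diagonal_neighbourhoods_half[OF X W1(1,2)] by blast
  obtain W where W: "openin (prod_topology X X) W" "Id_on ?S \<subseteq> W" "W O W \<subseteq> V"
    using diagonal_neighbourhoods_half[OF X V(1,2)] by blast
  obtain \<P> where P: "finite \<P>" "\<Union>\<P> = ?S" "\<And>P. P \<in> \<P> \<Longrightarrow> closedin X P"
    "\<And>P. P \<in> \<P> \<Longrightarrow> P \<times> P \<subseteq> W"
    using small_closed_cover[OF X W(1,2)] by blast
  have clusters: "\<exists>A\<in>\<A>. \<Union>\<Q> \<subseteq> A"
    if Q: "\<Q> \<subseteq> \<P>" "?S \<noteq> {}" "\<forall>P\<in>\<Q>. \<forall>Q\<in>\<Q>. P \<times> Q \<inter> W \<noteq> {}" for \<Q>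
  proof (cases "\<Q> = {}")
    case True
    have "\<A> \<noteq> {}" using Q(2) cover unfolding finite_open_cover_def by blast
    with True show ?thesis by auto
  next
    case False
    then obtain P where PQ: "P \<in> \<Q>" by blast
    then obtain p where p: "p \<in> P" using Q(3) by blast
    have pS: "p \<in> ?S" using p PQ Q(1) P(2) by blast
    have "(p, y) \<in> W1" if R: "R \<in> \<Q>" "y \<in> R" for R y
    proof -
      obtain u v where uv: "u \<in> P" "v \<in> R" "(u, v) \<in> W" using Q(3) PQ R(1) by blast
      have "(p, u) \<in> W" using P(4)[of P] PQ Q(1) p uv(1) by blast
      then have 1: "(p, v) \<in> V" using uv(3) W(3) by blast
      have "(v, y) \<in> W" using P(4)[of R] R Q(1) uv(2) by blast
      moreover have "(y, y) \<in> W" using W(2) P(2) R Q(1) by blast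
      ultimately have "(v, y) \<in> V" using W(3) by blast
      with 1 show ?thesis using V(3) by blast
    qed
    then have "\<Union>\<Q> \<subseteq> W1 `` {p}" by blast
    with W1(3)[OF pS] show ?thesis by blast
  qed
  show ?thesis by (rule that[OF P(1-3) W(1,2) clusters])
qed

section \<open>Integer iterates\<close>

lemma int_iterate_in:
  assumes "bij_betw T S S" "x \<in> S"
  shows "int_iterate S T n x \<in> S"
proof -
  have 1: "(T ^^ k) x \<in> S" for k
    by (induction k) (use assms bij_betwE in auto)
  have "inv_into S T y \<in> S" if "y \<in> S" for y
    using that assms by (metis bij_betw_imp_surj_on inv_into_into)
  then have 2: "(inv_into S T ^^ k) x \<in> S" for k
    by (induction k) (use assms in auto)
  show ?thesis unfolding int_iterate_def using 1 2 by simp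
qed

lemma int_iterate_Suc:
  assumes "bij_betw T S S" "x \<in> S"
  shows "int_iterate S T (n + 1) x = T (int_iterate S T n x)"
proof (cases "0 \<le> n")
  case True
  then have "nat (n + 1) = Suc (nat n)" by simp
  with True show ?thesis unfolding int_iterate_def by simp
next
  case False
  define k where "k = nat (- (n + 1))"
  have k: "nat (- n) = Suc k" using False unfolding k_def by simp
  have n: "int_iterate S T n x = inv_into S T ((inv_into S T ^^ k) x)"
    unfolding int_iterate_def k using False by simp
  have n1: "int_iterate S T (n + 1) x = (inv_into S T ^^ k) x"
  proof (cases "n + 1 = 0")
    case True
    then show ?thesis unfolding int_iterate_def k_def by simp
  next
    case False2: False
    with False show ?thesis unfolding int_iterate_def k_def by simp
  qed
  have "(inv_into S T ^^ k) x \<in> S" using int_iterate_in[OF assms, of "n+1"] n1 by simp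
  then show ?thesis unfolding n n1
    using assms(1) by (metis bij_betw_imp_surj_on f_inv_into_f)
qed

text \<open>Integer iterates are the only two-sided orbits: forwards this is immediate, backwards it is the
  injectivity of \<open>T\<close>. The laws for sums of exponents and for invariant subsets follow without
  a case distinction on signs.\<close>

lemma int_iterate_unique:
  assumes T: "bij_betw T S S" and f: "\<And>n. f n \<in> S" "\<And>n. f (n + 1) = T (f n)"
  shows "f n = int_iterate S T n (f 0)"
proof (induction n rule: int_induct[where k = 0])
  case base
  then show ?case by (simp add: int_iterate_def)
next
  case (step1 i)
  then show ?case using f int_iterate_Suc[OF T f(1)] by simp
next
  case (step2 i)
  have "T (f (i - 1)) = T (int_iterate S T (i - 1) (f 0))"
    using step2 f(2)[of "i - 1"] int_iterate_Suc[OF T f(1), of "i - 1" 0] by simp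
  then show ?case
    using T f(1) int_iterate_in[OF T f(1)] by (metis bij_betw_imp_inj_on inj_onD)
qed

lemma int_iterate_add:
  assumes T: "bij_betw T S S" and x: "x \<in> S"
  shows "int_iterate S T (m + n) x = int_iterate S T m (int_iterate S T n x)"
proof -
  have "int_iterate S T (i + 1 + n) x = T (int_iterate S T (i + n) x)" for i
    using int_iterate_Suc[OF T x, of "i + n"] by (simp add: algebra_simps)
  with int_iterate_unique[OF T, of "\<lambda>i. int_iterate S T (i + n) x" m] int_iterate_in[OF T x]
  show ?thesis by simp
qed

lemma int_iterate_subset:
  assumes T: "bij_betw T S S" and L: "L \<subseteq> S" "T ` L = L" and x: "x \<in> L"
  shows "int_iterate L T n x = int_iterate S T n x"
proof -
  have TL: "bij_betw T L L"
    using T L by (metis bij_betw_def inj_on_subset)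
  have "int_iterate L T n x = int_iterate S T n (int_iterate L T 0 x)"
    using int_iterate_in[OF TL x] int_iterate_Suc[OF TL x] L(1)
    by (intro int_iterate_unique[OF T]) blast+
  then show ?thesis by (simp add: int_iterate_def)
qed

lemma bij_betw_homeomorphic_map:
  assumes "homeomorphic_map X X T"
  shows "bij_betw T (topspace X) (topspace X)"
  using assms by (simp add: bij_betw_def homeomorphic_imp_injective_map
      homeomorphic_imp_surjective_map)

lemma continuous_map_funpow:
  "continuous_map X X f \<Longrightarrow> continuous_map X X (f ^^ (n :: nat))"
  by (induction n) (auto simp: continuous_map_compose id_def[symmetric])

lemma continuous_map_int_iterate:
  assumes T: "homeomorphic_map X X T"
  shows "continuous_map X X (int_iterate (topspace X) T n)"
proof -
  let ?S = "topspace X"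
  obtain g where g: "homeomorphic_maps X X T g"
    using T homeomorphic_map_maps by blast
  have "continuous_map X X (inv_into ?S T)"
  proof (rule continuous_map_eq)
    show "continuous_map X X g" using g homeomorphic_maps_def by blast
    show "g x = inv_into ?S T x" if "x \<in> ?S" for x
    proof -
      have "g x \<in> ?S" "T (g x) = x"
        using g that unfolding homeomorphic_maps_def continuous_map_def by auto
      then show ?thesis
        using inv_into_f_f[OF homeomorphic_imp_injective_map[OF T], of "g x"] by simp
    qed
  qed
  moreover have "continuous_map X X T"
    using T homeomorphic_imp_continuous_map by blast
  ultimately show ?thesis unfolding int_iterate_def
    using continuous_map_funpow by auto
qed

section \<open>Fragmentation\<close>

text \<open>The definition of HNS speaks only of invariant closed sets, but it forces every nonempty set \<open>A\<close>
  to have a nonempty relatively open part all of whose iterates are small. Apply non-sensitivity to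
  the closure \<open>L\<close> of the full orbit of \<open>A\<close>: the open set found there meets some iterate of \<open>A\<close>,
  and pulling it back to \<open>A\<close> only shifts the exponents, over all of which smallness is required.\<close>

lemma HNS_fragmented:
  assumes X: "compact_space X" "Hausdorff_space X" and T: "homeomorphic_map X X T"
    and HNS: "HNS X T"
    and A: "A \<subseteq> topspace X" "A \<noteq> {}"
    and W: "openin (prod_topology X X) W" "Id_on (topspace X) \<subseteq> W"
  obtains G where "openin X G" "G \<inter> A \<noteq> {}"
    "\<And>s t n. \<lbrakk>s \<in> G \<inter> A; t \<in> G \<inter> A\<rbrakk> \<Longrightarrow> ((T ^^ n) s, (T ^^ n) t) \<in> W"
proof -
  let ?S = "topspace X" and ?I = "int_iterate (topspace X) T"
  have bij: "bij_betw T ?S ?S" by (rule bij_betw_homeomorphic_map[OF T])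
  define Orb where "Orb = (\<Union>n. ?I n ` A)"
  define L where "L = X closure_of Orb"
  have OrbS: "Orb \<subseteq> ?S" unfolding Orb_def using int_iterate_in[OF bij] A by blast
  have LS: "L \<subseteq> ?S" unfolding L_def by (rule closure_of_subset_topspace)
  have OrbL: "Orb \<subseteq> L" unfolding L_def using OrbS by (rule closure_of_subset)
  have "T ` Orb = Orb"
  proof
    show "T ` Orb \<subseteq> Orb"
    proof clarify
      fix y assume "y \<in> Orb"
      then obtain n a where "a \<in> A" "y = ?I n a" unfolding Orb_def by blast
      then have "T y = ?I (n + 1) a" "a \<in> A" using int_iterate_Suc[OF bij] A(1) by auto
      then show "T y \<in> Orb" unfolding Orb_def by blast
    qed
    show "Orb \<subseteq> T ` Orb"
    proof
      fix y assume "y \<in> Orb"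
      then obtain n a where a: "a \<in> A" "y = ?I n a" unfolding Orb_def by blast
      then have "y = T (?I (n - 1) a)" using int_iterate_Suc[OF bij, of a "n - 1"] A(1) by auto
      moreover have "?I (n - 1) a \<in> Orb" unfolding Orb_def using a by blast
      ultimately show "y \<in> T ` Orb" by blast
    qed
  qed
  then have TL: "T ` L = L"
    using homeomorphic_map_closure_of[OF T OrbS] unfolding L_def by simp
  have "Orb \<noteq> {}" unfolding Orb_def using A by blast
  then have "L \<noteq> {}" using OrbL by blast
  moreover have Lclosed: "closedin X L" unfolding L_def by simp
  ultimately have ns: "not_sensitive (subtopology X L) T"
    using HNS TL unfolding HNS_def by blast
  have topL: "topspace (subtopology X L) = L" using LS by auto
  have comp: "compact_space (subtopology X L)"
    using X(1) Lclosed closedin_compact_space compact_space_subtopology by blast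
  have unif: "the_uniformity (subtopology X L) = diagonal_neighbourhoods (subtopology X L)"
    using comp X(2) Hausdorff_space_subtopology the_uniformity_eq by blast
  have "W \<inter> L \<times> L \<in> the_uniformity (subtopology X L)"
  proof -
    have "openin (prod_topology (subtopology X L) (subtopology X L)) (W \<inter> L \<times> L)"
      using W(1) by (metis openin_subtopology_Int subtopology_Times)
    moreover have "Id_on L \<subseteq> W \<inter> L \<times> L" using W(2) LS by auto
    ultimately show ?thesis
      unfolding unif diagonal_neighbourhoods_def topL by blast
  qed
  with ns obtain G where G: "openin (subtopology X L) G" "G \<noteq> {}"
    and small: "\<forall>s\<in>G. \<forall>t\<in>G. \<forall>n::int.
      (int_iterate L T n s, int_iterate L T n t) \<in> W \<inter> L \<times> L"
    unfolding not_sensitive_def topL by (elim ballE[of _ _ "W \<inter> L \<times> L"]) auto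
  obtain O' where O': "openin X O'" "G = O' \<inter> L"
    using G(1) unfolding openin_subtopology by blast
  have "O' \<inter> L \<noteq> {}" using G(2) O'(2) by simp
  then have "O' \<inter> Orb \<noteq> {}"
    unfolding L_def openin_Int_closure_of_eq_empty[OF O'(1)] .
  then obtain m a where a: "a \<in> A" "?I m a \<in> O'" unfolding Orb_def by blast
  define H where "H = {x \<in> ?S. ?I m x \<in> O'}"
  have Hopen: "openin X H" unfolding H_def
    by (rule openin_continuous_map_preimage[OF continuous_map_int_iterate[OF T] O'(1)])
  have "a \<in> H" using a A(1) unfolding H_def by blast
  then have HA: "H \<inter> A \<noteq> {}" using a(1) by blast
  have moved: "?I m x \<in> G" "int_iterate L T (int n - m) (?I m x) = (T ^^ n) x"
    if x: "x \<in> H \<inter> A" for x n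
  proof -
    have "?I m x \<in> Orb" using x unfolding Orb_def by blast
    then have xL: "?I m x \<in> L" using OrbL by blast
    then show "?I m x \<in> G" using x O'(2) unfolding H_def by blast
    have xS: "x \<in> ?S" using x A(1) by blast
    have "int_iterate L T (int n - m) (?I m x) = ?I (int n - m) (?I m x)"
      by (rule int_iterate_subset[OF bij LS TL xL])
    also have "\<dots> = ?I (int n) x"
      using int_iterate_add[OF bij xS, of "int n - m" m] by simp
    finally show "int_iterate L T (int n - m) (?I m x) = (T ^^ n) x"
      by (simp add: int_iterate_def)
  qed
  have "((T ^^ n) s, (T ^^ n) t) \<in> W" if st: "s \<in> H \<inter> A" "t \<in> H \<inter> A" for s t n
    using small[rule_format, OF moved(1)[OF st(1)] moved(1)[OF st(2)], of "int n - m"]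
    unfolding moved(2)[OF st(1)] moved(2)[OF st(2)] by blast
  then show ?thesis by (rule that[OF Hopen HA])
qed

text \<open>The complement of \<open>V\<close> is a minimal closed set meeting all members of \<open>\<L>\<close>. In terms of open sets the
  chain condition of Zorn's lemma is just compactness of the members of \<open>\<L>\<close>.\<close>

lemma maximal_open_containing_no_member:
  assumes \<L>: "\<And>F. F \<in> \<L> \<Longrightarrow> compactin X F \<and> F \<noteq> {}"
  obtains V where "openin X V" "\<And>F. F \<in> \<L> \<Longrightarrow> \<not> F \<subseteq> V"
    "\<And>G. \<lbrakk>openin X G; \<not> G \<subseteq> V\<rbrakk> \<Longrightarrow> \<exists>F\<in>\<L>. F \<subseteq> V \<union> G"
proof -
  define \<V> where "\<V> = {V. openin X V \<and> (\<forall>F\<in>\<L>. \<not> F \<subseteq> V)}"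
  have "\<exists>M\<in>\<V>. \<forall>V\<in>\<V>. M \<subseteq> V \<longrightarrow> V = M"
  proof (rule subset_Zorn_nonempty)
    show "\<V> \<noteq> {}" unfolding \<V>_def using \<L> by (auto intro!: exI[of _ "{}"])
    fix \<C> assume C: "\<C> \<noteq> {}" "subset.chain \<V> \<C>"
    then have CV: "\<C> \<subseteq> \<V>" unfolding subset.chain_def by blast
    have "\<not> F \<subseteq> \<Union>\<C>" if F: "F \<in> \<L>" for F
    proof
      assume "F \<subseteq> \<Union>\<C>"
      then obtain \<F> where fin: "finite \<F>" "\<F> \<subseteq> \<C>" "F \<subseteq> \<Union>\<F>"
        using \<L>[OF F] CV unfolding \<V>_def compactin_def by blast
      then have "\<F> \<noteq> {}" using \<L>[OF F] by blast
      moreover have "subset.chain \<V> \<F>" using C(2) fin(2) unfolding subset.chain_def by blast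
      ultimately have "\<Union>\<F> \<in> \<F>" using fin(1) Union_in_chain by blast
      then show False using fin CV F unfolding \<V>_def by blast
    qed
    then show "\<Union>\<C> \<in> \<V>" using CV unfolding \<V>_def by blast
  qed
  then obtain M where M: "M \<in> \<V>" "\<And>V. V \<in> \<V> \<Longrightarrow> M \<subseteq> V \<Longrightarrow> V = M" by blast
  have max: "\<exists>F\<in>\<L>. F \<subseteq> M \<union> G" if "openin X G" "\<not> G \<subseteq> M" for G
    using M(1) M(2)[of "M \<union> G"] that unfolding \<V>_def by blast
  have "openin X M" using M(1) unfolding \<V>_def by blast
  moreover have "\<not> F \<subseteq> M" if "F \<in> \<L>" for F using M(1) that unfolding \<V>_def by blast
  ultimately show ?thesis using max by (rule that)
qed

text \<open>Let \<open>A\<close> be a minimal closed set meeting all members of \<open>\<L>\<close>. By minimality a nonempty relatively open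
  part of \<open>A\<close> contains \<open>F \<inter> A\<close> for some member \<open>F\<close>. The two separated members
  inside \<open>F\<close> meet \<open>A\<close> again, so this part contains two points which some iterate of \<open>T\<close> carries to a pair outside \<open>W\<close>; this contradicts
  \<open>HNS_fragmented\<close>. Minimality replaces the construction of a binary tree of members.\<close>

lemma HNS_no_splitting_family:
  assumes X: "compact_space X" "Hausdorff_space X" and T: "homeomorphic_map X X T"
    and HNS: "HNS X T"
    and W: "openin (prod_topology X X) W" "Id_on (topspace X) \<subseteq> W"
    and \<L>: "\<And>F. F \<in> \<L> \<Longrightarrow> closedin X F \<and> F \<noteq> {}"
    and split: "\<And>F. F \<in> \<L> \<Longrightarrow> \<exists>F0\<in>\<L>. \<exists>F1\<in>\<L>. \<exists>n. F0 \<subseteq> F \<and> F1 \<subseteq> F \<and>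
        (T ^^ n) ` F0 \<times> (T ^^ n) ` F1 \<inter> W = {}"
  shows "\<L> = {}"
proof (rule ccontr)
  assume "\<L> \<noteq> {}"
  have compL: "compactin X F \<and> F \<noteq> {}" if "F \<in> \<L>" for F
    using \<L>[OF that] X(1) closedin_compact_space by blast
  obtain V where V: "openin X V" "\<And>F. F \<in> \<L> \<Longrightarrow> \<not> F \<subseteq> V"
    "\<And>G. \<lbrakk>openin X G; \<not> G \<subseteq> V\<rbrakk> \<Longrightarrow> \<exists>F\<in>\<L>. F \<subseteq> V \<union> G"
    using maximal_open_containing_no_member[of \<L>, OF compL] by metis
  define A where "A = topspace X - V"
  have LS: "F \<subseteq> topspace X" if "F \<in> \<L>" for F using \<L>[OF that] closedin_subset by blast
  have "A \<noteq> {}" using \<open>\<L> \<noteq> {}\<close> V(2) LS unfolding A_def by blast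
  have AS: "A \<subseteq> topspace X" unfolding A_def by blast
  obtain G where G: "openin X G" "G \<inter> A \<noteq> {}"
    "\<And>s t n. \<lbrakk>s \<in> G \<inter> A; t \<in> G \<inter> A\<rbrakk> \<Longrightarrow> ((T ^^ n) s, (T ^^ n) t) \<in> W"
    using HNS_fragmented[OF X T HNS AS \<open>A \<noteq> {}\<close> W] by metis
  have "\<not> G \<subseteq> V" using G(2) unfolding A_def by blast
  then obtain F where F: "F \<in> \<L>" "F \<subseteq> V \<union> G" using V(3)[OF G(1)] by blast
  obtain F0 F1 n where F01: "F0 \<in> \<L>" "F1 \<in> \<L>" "F0 \<subseteq> F" "F1 \<subseteq> F"
    "(T ^^ n) ` F0 \<times> (T ^^ n) ` F1 \<inter> W = {}"
    using split[OF F(1)] by blast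
  obtain s t where "s \<in> F0 - V" "t \<in> F1 - V" using V(2) F01(1,2) by blast
  then have "s \<in> G \<inter> A" "t \<in> G \<inter> A" "s \<in> F0" "t \<in> F1"
    using F(2) F01 LS unfolding A_def by blast+
  then show False using G(3)[of s t n] F01(5) by blast
qed

section \<open>A splitting game\<close>

text \<open>The first player survives \<open>k\<close> further rounds from the set \<open>F\<close> with credit \<open>a\<close>. After every
  round the current set is moved on by \<open>T\<close>, so that the cells \<open>P\<close> and \<open>Q\<close> always refer to the
  present time. Waiting with credit \<open>0\<close> loses.\<close>

primrec survives ::
  "('a \<Rightarrow> 'a) \<Rightarrow> 'a set set \<Rightarrow> ('a \<times> 'a) set \<Rightarrow> nat \<Rightarrow> nat \<Rightarrow> nat \<Rightarrow> 'a set \<Rightarrow> bool" where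
  "survives T \<P> W m 0 a F \<longleftrightarrow> F \<noteq> {}"
| "survives T \<P> W m (Suc k) a F \<longleftrightarrow> F \<noteq> {} \<and>
     ((\<exists>b. a = Suc b \<and> survives T \<P> W m k b (T ` F)) \<or>
      (\<exists>P\<in>\<P>. \<exists>Q\<in>\<P>. P \<times> Q \<inter> W = {} \<and>
         survives T \<P> W m k (a + m) (T ` (F \<inter> P)) \<and>
         survives T \<P> W m k (a + m) (T ` (F \<inter> Q))))"

lemma survives_mono:
  "survives T \<P> W m k a F \<Longrightarrow> F \<subseteq> F' \<Longrightarrow> survives T \<P> W m k a F'"
proof (induction k arbitrary: a F F')
  case (Suc k)
  have ne: "F' \<noteq> {}" using Suc.prems by auto
  have idle: "T ` F \<subseteq> T ` F'" and cell: "T ` (F \<inter> P) \<subseteq> T ` (F' \<inter> P)" for P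
    using Suc.prems(2) by blast+
  from Suc.prems(1) consider b where "a = Suc b" "survives T \<P> W m k b (T ` F)"
    | P Q where "P \<in> \<P>" "Q \<in> \<P>" "P \<times> Q \<inter> W = {}"
        "survives T \<P> W m k (a + m) (T ` (F \<inter> P))" "survives T \<P> W m k (a + m) (T ` (F \<inter> Q))"
    unfolding survives.simps by blast
  then show ?case
  proof cases
    case 1
    from Suc.IH[OF this(2) idle] this(1) ne show ?thesis by simp
  next
    case 2
    from Suc.IH[OF 2(4) cell] Suc.IH[OF 2(5) cell] 2(1-3) ne show ?thesis
      unfolding survives.simps by blast
  qed
qed auto

lemma survives_antimono_rounds:
  "survives T \<P> W m k a F \<Longrightarrow> l \<le> k \<Longrightarrow> survives T \<P> W m l a F"
proof (induction k arbitrary: a F l)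
  case (Suc k)
  show ?case
  proof (cases l)
    case 0
    with Suc.prems show ?thesis by simp
  next
    case (Suc l')
    with Suc.prems(2) have l': "l' \<le> k" by simp
    have ne: "F \<noteq> {}" using Suc.prems by simp
    from Suc.prems(1) consider b where "a = Suc b" "survives T \<P> W m k b (T ` F)"
      | P Q where "P \<in> \<P>" "Q \<in> \<P>" "P \<times> Q \<inter> W = {}"
          "survives T \<P> W m k (a + m) (T ` (F \<inter> P))" "survives T \<P> W m k (a + m) (T ` (F \<inter> Q))"
      unfolding survives.simps by blast
    then show ?thesis
    proof cases
      case 1
      from Suc.IH[OF this(2) l'] this(1) ne show ?thesis unfolding Suc by simp
    next
      case 2
      from Suc.IH[OF 2(4) l'] Suc.IH[OF 2(5) l'] 2(1-3) ne show ?thesis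
        unfolding Suc survives.simps by blast
    qed
  qed
qed auto

text \<open>There are finitely many possible first moves, and surviving more rounds is harder. So one first move
  serves for all numbers of rounds; this replaces a compactness argument for infinite strategies.\<close>

lemma survives_forever_step:
  assumes fin: "finite \<P>" and forever: "\<And>k. survives T \<P> W m k a F"
  shows "(\<exists>b. a = Suc b \<and> (\<forall>k. survives T \<P> W m k b (T ` F))) \<or>
      (\<exists>P\<in>\<P>. \<exists>Q\<in>\<P>. P \<times> Q \<inter> W = {} \<and>
         (\<forall>k. survives T \<P> W m k (a + m) (T ` (F \<inter> P))) \<and>
         (\<forall>k. survives T \<P> W m k (a + m) (T ` (F \<inter> Q))))"
proof (rule ccontr)
  let ?s = "survives T \<P> W m"
  assume neg: "\<not> ?thesis"
  obtain k0 where k0: "\<And>b. a = Suc b \<Longrightarrow> \<not> ?s k0 b (T ` F)"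
  proof (cases a)
    case 0
    then show ?thesis using that by simp
  next
    case (Suc b)
    then show ?thesis using that neg by auto
  qed
  define f where "f P = (SOME k. \<not> ?s k (a + m) (T ` (F \<inter> P)))" for P
  have f: "\<not> ?s (f P) (a + m) (T ` (F \<inter> P))" if "\<not> ?s k (a + m) (T ` (F \<inter> P))" for P k
    unfolding f_def using someI[of "\<lambda>k. \<not> ?s k (a + m) (T ` (F \<inter> P))", OF that] .
  (* a sum instead of a maximum, so that an empty \<P> needs no separate treatment *)
  define N where "N = k0 + sum f \<P>"
  have fN: "f P \<le> N" if "P \<in> \<P>" for P
    unfolding N_def using member_le_sum[OF that, of f] fin by simp
  have "\<not> ?s N b (T ` F)" if "a = Suc b" for b
    using k0[OF that] survives_antimono_rounds[of T \<P> W m N b "T ` F" k0] unfolding N_def by auto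
  moreover have "\<forall>k. ?s k (a + m) (T ` (F \<inter> P))" if "P \<in> \<P>" "?s N (a + m) (T ` (F \<inter> P))" for P
    using f survives_antimono_rounds[OF that(2) fN[OF that(1)]] by blast
  moreover have "?s (Suc N) a F" by (rule forever)
  ultimately show False using neg unfolding survives.simps by blast
qed

text \<open>Every wait lowers the credit, so a player who survives forever splits at some time \<open>n'\<close>.
  The halves are expressed as preimages inside the original set \<open>F\<close>, so that they are closed
  if \<open>F\<close> and the cells are, and can serve as members of a splitting family.\<close>

lemma survives_forever_splits:
  assumes "finite \<P>" and "\<And>k. survives T \<P> W m k a ((T ^^ n) ` F)"
  shows "\<exists>n' a' P Q. P \<in> \<P> \<and> Q \<in> \<P> \<and> P \<times> Q \<inter> W = {} \<and>
     (\<forall>k. survives T \<P> W m k a' ((T ^^ Suc n') ` {x \<in> F. (T ^^ n') x \<in> P})) \<and>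
     (\<forall>k. survives T \<P> W m k a' ((T ^^ Suc n') ` {x \<in> F. (T ^^ n') x \<in> Q}))"
  using assms(2)
proof (induction a arbitrary: n)
  case (0 n)
  have eq: "T ` ((T ^^ n) ` F \<inter> P) = (T ^^ Suc n) ` {x \<in> F. (T ^^ n) x \<in> P}" for P
    by auto
  from survives_forever_step[OF assms(1) 0] show ?case unfolding eq by blast
next
  case (Suc a n)
  have eq: "T ` ((T ^^ n) ` F \<inter> P) = (T ^^ Suc n) ` {x \<in> F. (T ^^ n) x \<in> P}" for P
    by auto
  have eq': "T ` (T ^^ n) ` F = (T ^^ Suc n) ` F" by auto
  from survives_forever_step[OF assms(1) Suc.prems] show ?case
  proof (elim disjE exE conjE)
    fix b assume "Suc a = Suc b" "\<forall>k. survives T \<P> W m k b (T ` (T ^^ n) ` F)"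
    then show ?thesis using Suc.IH[of "Suc n"] unfolding eq' by blast
  next
    assume "\<exists>P\<in>\<P>. \<exists>Q\<in>\<P>. P \<times> Q \<inter> W = {} \<and>
         (\<forall>k. survives T \<P> W m k (Suc a + m) (T ` ((T ^^ n) ` F \<inter> P))) \<and>
         (\<forall>k. survives T \<P> W m k (Suc a + m) (T ` ((T ^^ n) ` F \<inter> Q)))"
    then show ?thesis unfolding eq by blast
  qed
qed

text \<open>The number of rounds \<open>k\<close> depends on \<open>m\<close> but, by monotonicity of the game, not on the initial set.
  This uniformity is what allows the opponent to restart the strategy.\<close>

lemma HNS_loses_splitting_game:
  assumes X: "compact_space X" "Hausdorff_space X" and T: "homeomorphic_map X X T"
    and HNS: "HNS X T"
    and W: "openin (prod_topology X X) W" "Id_on (topspace X) \<subseteq> W"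
    and P: "finite \<P>" "\<And>P. P \<in> \<P> \<Longrightarrow> closedin X P"
  obtains k where "\<And>F. F \<subseteq> topspace X \<Longrightarrow> \<not> survives T \<P> W m k m F"
proof -
  define \<L> where "\<L> = {F. closedin X F \<and> (\<exists>a n. \<forall>k. survives T \<P> W m k a ((T ^^ n) ` F))}"
  have memL: "F \<in> \<L>" if "closedin X F" "\<And>k. survives T \<P> W m k a ((T ^^ n) ` F)" for F a n
    unfolding \<L>_def using that by blast
  have "\<L> = {}"
  proof (rule HNS_no_splitting_family[OF X T HNS W])
    show "closedin X F \<and> F \<noteq> {}" if F: "F \<in> \<L>" for F
    proof -
      obtain a n where "survives T \<P> W m 0 a ((T ^^ n) ` F)" using F unfolding \<L>_def by blast
      then show ?thesis using F unfolding \<L>_def by auto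
    qed
    show "\<exists>F0\<in>\<L>. \<exists>F1\<in>\<L>. \<exists>n. F0 \<subseteq> F \<and> F1 \<subseteq> F \<and>
        (T ^^ n) ` F0 \<times> (T ^^ n) ` F1 \<inter> W = {}" if F: "F \<in> \<L>" for F
    proof -
      have Fc: "closedin X F" using F unfolding \<L>_def by blast
      obtain a n where "\<And>k. survives T \<P> W m k a ((T ^^ n) ` F)"
        using F unfolding \<L>_def by blast
      from survives_forever_splits[OF P(1) this] obtain n' a' P Q where PQ: "P \<in> \<P>" "Q \<in> \<P>"
        "P \<times> Q \<inter> W = {}"
        "\<And>k. survives T \<P> W m k a' ((T ^^ Suc n') ` {x \<in> F. (T ^^ n') x \<in> P})"
        "\<And>k. survives T \<P> W m k a' ((T ^^ Suc n') ` {x \<in> F. (T ^^ n') x \<in> Q})"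
        by blast
      have cont: "continuous_map X X (T ^^ n')"
        by (rule continuous_map_funpow[OF homeomorphic_imp_continuous_map[OF T]])
      have cl: "closedin X {x \<in> F. (T ^^ n') x \<in> R}" if "R \<in> \<P>" for R
      proof -
        have "closedin X (F \<inter> {x \<in> topspace X. (T ^^ n') x \<in> R})"
          by (rule closedin_Int[OF Fc closedin_continuous_map_preimage[OF cont P(2)[OF that]]])
        moreover have "F \<inter> {x \<in> topspace X. (T ^^ n') x \<in> R} = {x \<in> F. (T ^^ n') x \<in> R}"
          using closedin_subset[OF Fc] by blast
        ultimately show ?thesis by simp
      qed
      have "{x \<in> F. (T ^^ n') x \<in> P} \<in> \<L>" "{x \<in> F. (T ^^ n') x \<in> Q} \<in> \<L>"
        by (rule memL[OF cl[OF PQ(1)] PQ(4)], rule memL[OF cl[OF PQ(2)] PQ(5)])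
      moreover have "{x \<in> F. (T ^^ n') x \<in> P} \<subseteq> F" "{x \<in> F. (T ^^ n') x \<in> Q} \<subseteq> F" by blast+
      moreover have "(T ^^ n') ` {x \<in> F. (T ^^ n') x \<in> P} \<times> (T ^^ n') ` {x \<in> F. (T ^^ n') x \<in> Q}
          \<inter> W = {}"
        using PQ(3) by auto
      ultimately show ?thesis by blast
    qed
  qed
  have "\<exists>k. \<not> survives T \<P> W m k m (topspace X)"
  proof (rule ccontr)
    assume "\<not> ?thesis"
    then have "topspace X \<in> \<L>" by (intro memL[of _ m 0]) auto
    with \<open>\<L> = {}\<close> show False by blast
  qed
  then obtain k where "\<not> survives T \<P> W m k m (topspace X)" by blast
  then show ?thesis using survives_mono by (intro that[of k]) blast
qed

section \<open>Counting\<close>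

text \<open>The bound is real, because the estimates below are weighted by powers of a real base.\<close>

definition coverable :: "'a topology \<Rightarrow> ('a \<Rightarrow> 'a) \<Rightarrow> 'a set set \<Rightarrow> nat \<Rightarrow> 'a set \<Rightarrow> real \<Rightarrow> bool" where
  "coverable X T \<A> n F b \<longleftrightarrow>
     (\<exists>\<D>\<subseteq>iterated_cover X T \<A> n. finite \<D> \<and> real (card \<D>) \<le> b \<and> F \<subseteq> \<Union>\<D>)"

lemma coverable_mono:
  "coverable X T \<A> n F b \<Longrightarrow> F' \<subseteq> F \<Longrightarrow> b \<le> b' \<Longrightarrow> coverable X T \<A> n F' b'"
  unfolding coverable_def by (meson order_trans)

lemma coverable_empty: "0 \<le> b \<Longrightarrow> coverable X T \<A> n {} b"
  unfolding coverable_def by (intro exI[of _ "{}"]) auto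

lemma coverable_0:
  assumes "F \<subseteq> topspace X" "1 \<le> b"
  shows "coverable X T \<A> 0 F b"
  unfolding coverable_def iterated_cover_def
  using assms by (intro exI[of _ "{topspace X}"]) auto

lemma coverable_Un:
  assumes "coverable X T \<A> n F b" "coverable X T \<A> n F' b'"
  shows "coverable X T \<A> n (F \<union> F') (b + b')"
proof -
  obtain \<D> where D: "\<D> \<subseteq> iterated_cover X T \<A> n" "finite \<D>" "real (card \<D>) \<le> b" "F \<subseteq> \<Union>\<D>"
    using assms(1) unfolding coverable_def by blast
  obtain \<D>' where D': "\<D>' \<subseteq> iterated_cover X T \<A> n" "finite \<D>'" "real (card \<D>') \<le> b'"
    "F' \<subseteq> \<Union>\<D>'"
    using assms(2) unfolding coverable_def by blast
  have "real (card (\<D> \<union> \<D>')) \<le> b + b'"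
    using card_Un_le[of \<D> \<D>'] D(3) D'(3) by linarith
  moreover have "\<D> \<union> \<D>' \<subseteq> iterated_cover X T \<A> n" "finite (\<D> \<union> \<D>')" "F \<union> F' \<subseteq> \<Union>(\<D> \<union> \<D>')"
    using D D' by blast+
  ultimately show ?thesis unfolding coverable_def by blast
qed

lemma coverable_UN:
  assumes "finite \<Q>" "\<And>Q. Q \<in> \<Q> \<Longrightarrow> coverable X T \<A> n (F Q) b"
  shows "coverable X T \<A> n (\<Union>Q\<in>\<Q>. F Q) (real (card \<Q>) * b)"
  using assms
proof (induction \<Q> rule: finite_induct)
  case empty
  then show ?case by (simp add: coverable_empty)
next
  case (insert Q \<Q>)
  then have "coverable X T \<A> n (F Q \<union> (\<Union>Q\<in>\<Q>. F Q)) (b + real (card \<Q>) * b)"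
    by (intro coverable_Un) auto
  with insert show ?case by (simp add: algebra_simps)
qed

lemma coverable_Suc:
  assumes T: "T \<in> topspace X \<rightarrow> topspace X" and A: "A \<in> \<A>" and F: "F \<subseteq> topspace X"
    and cov: "coverable X T \<A> n (T ` (F \<inter> A)) b"
  shows "coverable X T \<A> (Suc n) (F \<inter> A) b"
proof -
  let ?S = "topspace X"
  obtain \<D> where D: "\<D> \<subseteq> iterated_cover X T \<A> n" "finite \<D>" "real (card \<D>) \<le> b"
    "T ` (F \<inter> A) \<subseteq> \<Union>\<D>"
    using cov unfolding coverable_def by blast
  define pull where "pull D = {x \<in> ?S. x \<in> A \<and> T x \<in> D}" for D
  have "pull D \<in> iterated_cover X T \<A> (Suc n)" if D': "D \<in> \<D>" for D
  proof -
    obtain B where B: "D = {x \<in> ?S. \<forall>i<n. (T ^^ i) x \<in> B i}" "\<forall>i<n. B i \<in> \<A>"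
      using subsetD[OF D(1) D'] unfolding iterated_cover_def by auto
    have "pull D = {x \<in> ?S. \<forall>i<Suc n. (T ^^ i) x \<in> case_nat A B i}"
      unfolding pull_def B(1) using T by (auto simp: All_less_Suc2 funpow_swap1)
    moreover have "\<forall>i<Suc n. case_nat A B i \<in> \<A>" using A B(2) by (simp add: All_less_Suc2)
    ultimately show ?thesis unfolding iterated_cover_def by blast
  qed
  moreover have "real (card (pull ` \<D>)) \<le> b"
    using D(2,3) card_image_le[of \<D> pull] by linarith
  moreover have "F \<inter> A \<subseteq> \<Union> (pull ` \<D>)"
    unfolding pull_def using D(4) F by blast
  ultimately show ?thesis
    unfolding coverable_def using D(2) by (intro exI[of _ "pull ` \<D>"] conjI) blast+
qed

text \<open>The weight \<open>\<beta> ^ - a\<close> turns the count of words with few free letters into an induction on \<open>n\<close>.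
  Let \<open>\<Q>\<close> be the cells in which the first player would survive after earning \<open>m\<close>. No two
  of them are separated, since otherwise the player would survive by splitting \<open>F\<close> by them; so they
  lie in one member \<open>A\<close> of the cover. On \<open>F \<inter> A\<close> the player is treated as waiting, which costs a factor \<open>\<beta>\<close>; each of the
  other cells contributes a factor \<open>\<beta> ^ - m\<close>. Together they give the growth rate
  \<open>\<rho> = \<beta> + card \<P> / \<beta> ^ m\<close>. When waiting is impossible, at credit \<open>0\<close>, the
  game is restarted with \<open>k0\<close> rounds and credit \<open>m\<close>, and the bound only improves.

  The bound on \<open>a\<close> is the largest credit that can arise after \<open>k0 - k\<close> rounds; it makes the
  claim true for \<open>n = 0\<close>.\<close>

lemma coverable_if_game_lost:
  fixes \<beta> :: real
  assumes T: "T \<in> topspace X \<rightarrow> topspace X"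
    and P: "finite \<P>" "\<Union>\<P> = topspace X"
    and clusters: "\<And>\<Q>. \<lbrakk>\<Q> \<subseteq> \<P>; topspace X \<noteq> {}; \<forall>P\<in>\<Q>. \<forall>Q\<in>\<Q>. P \<times> Q \<inter> W \<noteq> {}\<rbrakk>
       \<Longrightarrow> \<exists>A\<in>\<A>. \<Union>\<Q> \<subseteq> A"
    and refl: "Id_on (topspace X) \<subseteq> W"
    and lost: "\<And>F. F \<subseteq> topspace X \<Longrightarrow> \<not> survives T \<P> W m k0 m F"
    and \<beta>: "1 \<le> \<beta>"
  defines "\<rho> \<equiv> \<beta> + real (card \<P>) / \<beta> ^ m" and "C \<equiv> \<beta> ^ (m * (k0 + 1))"
  shows "\<lbrakk>k \<le> k0; a \<le> m * (k0 - k + 1); F \<subseteq> topspace X; \<not> survives T \<P> W m k a F\<rbrakk>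
    \<Longrightarrow> coverable X T \<A> n F (C * \<rho> ^ n / \<beta> ^ a)"
proof (induction n arbitrary: k a F)
  case 0
  have "a \<le> m * (k0 + 1)"
    using 0(2) by (meson add_le_mono1 diff_le_self le_trans mult_le_mono2)
  then have "\<beta> ^ a \<le> C" unfolding C_def using \<beta> by (rule power_increasing)
  then show ?case using 0 \<beta> by (intro coverable_0) (auto simp: field_simps)
next
  case (Suc n)
  let ?S = "topspace X" and ?r = "real (card \<P>)"
  have pos: "0 < \<rho>" "0 < C" "0 < \<beta>" unfolding \<rho>_def C_def using \<beta>
    by (auto intro!: add_pos_nonneg)
  show ?case
  proof (cases "F = {}")
    case True
    then show ?thesis using pos by (auto intro!: coverable_empty)
  next
    case False
    then obtain l where k: "k = Suc l" using Suc.prems(4) by (cases k) auto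
    have nonempty: "?S \<noteq> {}" using False Suc.prems(3) by blast
    have TF: "T ` F' \<subseteq> ?S" if "F' \<subseteq> F" for F' using T Suc.prems(3) that by blast
    define \<Q> where "\<Q> = {P \<in> \<P>. survives T \<P> W m l (a + m) (T ` (F \<inter> P))}"
    have "\<exists>A\<in>\<A>. \<Union>\<Q> \<subseteq> A"
    proof (rule clusters)
      show "\<forall>P\<in>\<Q>. \<forall>Q\<in>\<Q>. P \<times> Q \<inter> W \<noteq> {}"
        using Suc.prems(4) False unfolding k survives.simps \<Q>_def by blast
    qed (use nonempty in \<open>auto simp: \<Q>_def\<close>)
    then obtain A where A: "A \<in> \<A>" "\<Union>\<Q> \<subseteq> A" by (rule bexE)
    have l: "l \<le> k0" using Suc.prems(1) k by simp
    have idle: "coverable X T \<A> n (T ` (F \<inter> A)) (C * \<rho> ^ n * \<beta> / \<beta> ^ a)"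
    proof (cases a)
      case 0
      (* credit exhausted: restart the game *)
      have "coverable X T \<A> n (T ` (F \<inter> A)) (C * \<rho> ^ n / \<beta> ^ m)"
        by (rule Suc.IH[OF order_refl _ TF[OF Int_lower1] lost[OF TF[OF Int_lower1]]]) simp
      moreover have "C * \<rho> ^ n / \<beta> ^ m \<le> C * \<rho> ^ n * \<beta> / \<beta> ^ a"
      proof -
        have "1 / \<beta> ^ m \<le> 1" using one_le_power[OF \<beta>, of m] by simp
        then have "1 / \<beta> ^ m \<le> \<beta>" using \<beta> by linarith
        then have "C * \<rho> ^ n * (1 / \<beta> ^ m) \<le> C * \<rho> ^ n * \<beta>"
          using pos by (intro mult_left_mono) auto
        then show ?thesis using 0 by simp
      qed
      ultimately show ?thesis by (rule coverable_mono[OF _ order_refl])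
    next
      case (Suc b)
      have "\<not> survives T \<P> W m l b (T ` F)" using Suc.prems(4) False Suc
        unfolding k survives.simps by blast
      then have "\<not> survives T \<P> W m l b (T ` (F \<inter> A))"
        using survives_mono[of T \<P> W m l b "T ` (F \<inter> A)" "T ` F"] by blast
      moreover have "b \<le> m * (k0 - l + 1)"
      proof -
        have "m * (k0 - k + 1) \<le> m * (k0 - l + 1)" unfolding k by (intro mult_le_mono2) simp
        then show ?thesis using Suc Suc.prems(2) by linarith
      qed
      ultimately have "coverable X T \<A> n (T ` (F \<inter> A)) (C * \<rho> ^ n / \<beta> ^ b)"
        by (intro Suc.IH[OF l] TF Int_lower1)
      moreover have "C * \<rho> ^ n * \<beta> / \<beta> ^ a = C * \<rho> ^ n / \<beta> ^ b"
        unfolding Suc using pos(3) by simp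
      ultimately show ?thesis by simp
    qed
    have cell: "coverable X T \<A> (Suc n) (F \<inter> P) (C * \<rho> ^ n / \<beta> ^ (a + m))" if P': "P \<in> \<P> - \<Q>" for P
    proof -
      have am: "a + m \<le> m * (k0 - l + 1)"
      proof -
        have "k0 - l = Suc (k0 - k)" using Suc.prems(1) k by simp
        then show ?thesis using Suc.prems(2) by simp
      qed
      have *: "\<not> survives T \<P> W m l (a + m) (T ` (F \<inter> P))" using P' unfolding \<Q>_def by blast
      have cov: "coverable X T \<A> n (T ` (F \<inter> P)) (C * \<rho> ^ n / \<beta> ^ (a + m))"
        by (rule Suc.IH[OF l am TF *]) auto
      show ?thesis
      proof (cases "P = {}")
        case True
        then show ?thesis using pos by (auto intro!: coverable_empty)
      next
        case False
        then obtain p where "p \<in> P" by blast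
        then have "(p, p) \<in> W" using refl P(2) P' by blast
        with \<open>p \<in> P\<close> have "P \<times> P \<inter> W \<noteq> {}" by blast
        then have "\<exists>B\<in>\<A>. \<Union>{P} \<subseteq> B" using P' nonempty by (intro clusters) auto
        then obtain B where B: "B \<in> \<A>" "P \<subseteq> B" by auto
        then have "F \<inter> P \<inter> B = F \<inter> P" by blast
        then show ?thesis
          using coverable_Suc[OF T B(1), of "F \<inter> P" n] cov Suc.prems(3) by auto
      qed
    qed
    let ?b = "C * \<rho> ^ n / \<beta> ^ (a + m)"
    have "coverable X T \<A> (Suc n) (F \<inter> A) (C * \<rho> ^ n * \<beta> / \<beta> ^ a)"
      by (rule coverable_Suc[OF T A(1) Suc.prems(3) idle])
    moreover have "coverable X T \<A> (Suc n) (\<Union>P\<in>\<P> - \<Q>. F \<inter> P) (real (card (\<P> - \<Q>)) * ?b)"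
      using P(1) cell by (intro coverable_UN) simp_all
    ultimately have "coverable X T \<A> (Suc n) ((F \<inter> A) \<union> (\<Union>P\<in>\<P> - \<Q>. F \<inter> P))
        (C * \<rho> ^ n * \<beta> / \<beta> ^ a + real (card (\<P> - \<Q>)) * ?b)"
      by (rule coverable_Un)
    moreover have "F \<subseteq> (F \<inter> A) \<union> (\<Union>P\<in>\<P> - \<Q>. F \<inter> P)"
    proof
      fix x assume x: "x \<in> F"
      then obtain P where "P \<in> \<P>" "x \<in> P" using Suc.prems(3) P(2) by blast
      with x A(2) show "x \<in> (F \<inter> A) \<union> (\<Union>P\<in>\<P> - \<Q>. F \<inter> P)"
        by (cases "P \<in> \<Q>") auto
    qed
    moreover have "C * \<rho> ^ n * \<beta> / \<beta> ^ a + real (card (\<P> - \<Q>)) * ?b \<le> C * \<rho> ^ Suc n / \<beta> ^ a"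
    proof -
      have "real (card (\<P> - \<Q>)) * ?b \<le> ?r * ?b"
        using pos card_mono[OF P(1) Diff_subset[of \<P> \<Q>]] by (intro mult_right_mono) simp_all
      also have "C * \<rho> ^ n * \<beta> / \<beta> ^ a + ?r * ?b = C * \<rho> ^ n * \<rho> / \<beta> ^ a"
        using pos unfolding \<rho>_def by (simp add: power_add field_simps)
      finally show ?thesis by (simp add: algebra_simps)
    qed
    ultimately show ?thesis by (rule coverable_mono)
  qed
qed

section \<open>Zero entropy\<close>

lemma cover_number_le:
  assumes "coverable X T \<A> n (topspace X) b"
  shows "real (cover_number X (iterated_cover X T \<A> n)) \<le> b"
proof -
  obtain \<D> where D: "\<D> \<subseteq> iterated_cover X T \<A> n" "finite \<D>" "real (card \<D>) \<le> b"
    "topspace X \<subseteq> \<Union>\<D>"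
    using assms unfolding coverable_def by blast
  have "\<Union>\<D> \<subseteq> topspace X" using D(1) unfolding iterated_cover_def by blast
  then have "cover_number X (iterated_cover X T \<A> n) \<le> card \<D>"
    unfolding cover_number_def using D by (intro Least_le) blast
  with D(3) show ?thesis by linarith
qed

text \<open>First \<open>\<beta>\<close> is chosen close to \<open>1\<close>, then \<open>m\<close> so large that the cells, whose number does not depend on
  \<open>m\<close>, add little to the rate \<open>\<beta> + card \<P> / \<beta> ^ m\<close>.\<close>

lemma HNS_cover_number_subexponential:
  assumes X: "compact_space X" "Hausdorff_space X" and T: "homeomorphic_map X X T"
    and HNS: "HNS X T" and cover: "finite_open_cover X \<A>" and \<epsilon>: "0 < \<epsilon>"
  obtains C where "1 \<le> C"
    "\<And>n. real (cover_number X (iterated_cover X T \<A> n)) \<le> C * (1 + \<epsilon>) ^ n"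
proof -
  obtain \<P> W where P: "finite \<P>" "\<Union>\<P> = topspace X" "\<And>P. P \<in> \<P> \<Longrightarrow> closedin X P"
    and W: "openin (prod_topology X X) W" "Id_on (topspace X) \<subseteq> W"
    and clusters: "\<And>\<Q>. \<lbrakk>\<Q> \<subseteq> \<P>; topspace X \<noteq> {}; \<forall>P\<in>\<Q>. \<forall>Q\<in>\<Q>. P \<times> Q \<inter> W \<noteq> {}\<rbrakk>
       \<Longrightarrow> \<exists>A\<in>\<A>. \<Union>\<Q> \<subseteq> A"
    by (rule clusters_of_small_sets[OF X cover]) (rule that)
  define \<beta> where "\<beta> = 1 + \<epsilon> / 2"
  have \<beta>: "1 < \<beta>" unfolding \<beta>_def using \<epsilon> by simp
  obtain m where m: "2 * real (card \<P>) / \<epsilon> < \<beta> ^ m"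
    using real_arch_pow[OF \<beta>] by blast
  have "real (card \<P>) / \<beta> ^ m \<le> \<epsilon> / 2"
    using m \<epsilon> \<beta> by (simp add: field_simps)
  then have \<rho>: "\<beta> + real (card \<P>) / \<beta> ^ m \<le> 1 + \<epsilon>" using \<beta>_def by linarith
  obtain k where k: "\<And>F. F \<subseteq> topspace X \<Longrightarrow> \<not> survives T \<P> W m k m F"
    by (rule HNS_loses_splitting_game[OF X T HNS W P(1,3), where m = m]) (assumption, rule that)
  let ?C = "\<beta> ^ (m * (k + 1))"
  have TS: "T \<in> topspace X \<rightarrow> topspace X"
    using homeomorphic_imp_surjective_map[OF T] by blast
  show ?thesis
  proof
    show "1 \<le> ?C" using \<beta> by (intro one_le_power) simp
    fix n
    have "coverable X T \<A> n (topspace X) (?C * (\<beta> + real (card \<P>) / \<beta> ^ m) ^ n / \<beta> ^ m)"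
      using coverable_if_game_lost[OF TS P(1,2) clusters W(2) k less_imp_le[OF \<beta>],
          of k m "topspace X" n] k by simp
    then have "real (cover_number X (iterated_cover X T \<A> n))
        \<le> ?C * (\<beta> + real (card \<P>) / \<beta> ^ m) ^ n / \<beta> ^ m"
      by (rule cover_number_le)
    also have "\<dots> \<le> ?C * (\<beta> + real (card \<P>) / \<beta> ^ m) ^ n"
    proof -
      have "0 \<le> ?C * (\<beta> + real (card \<P>) / \<beta> ^ m) ^ n" using \<beta> by simp
      from mult_left_mono[OF one_le_power[OF less_imp_le[OF \<beta>], of m] this]
      show ?thesis using \<beta> by (simp add: divide_le_eq)
    qed
    also have "\<dots> \<le> ?C * (1 + \<epsilon>) ^ n"
      using \<rho> \<beta> by (intro mult_left_mono power_mono) auto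
    finally show "real (cover_number X (iterated_cover X T \<A> n)) \<le> ?C * (1 + \<epsilon>) ^ n" .
  qed
qed

lemma HNS_cover_entropy:
  assumes "compact_space X" "Hausdorff_space X" "homeomorphic_map X X T" "HNS X T"
    and "finite_open_cover X \<A>"
  shows "cover_entropy X T \<A> = 0"
proof -
  define N where "N n = real (cover_number X (iterated_cover X T \<A> n))" for n
  have "(\<lambda>n. ln (N n) / real n) \<longlonglongrightarrow> 0"
  proof (rule LIMSEQ_I)
    fix r :: real assume r: "0 < r"
    obtain C where C: "1 \<le> C" "\<And>n. N n \<le> C * (1 + r / 2) ^ n"
      using HNS_cover_number_subexponential[OF assms, of "r / 2"] r unfolding N_def by auto
    obtain n0 where n0: "2 * ln C / r < real n0" using reals_Archimedean2 by blast
    have "norm (ln (N n) / real n - 0) < r" if n: "n0 < n" for n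
    proof -
      have N0: "0 \<le> ln (N n)" unfolding N_def by (cases "cover_number X (iterated_cover X T \<A> n)") auto
      have "ln (N n) \<le> ln C + real n * ln (1 + r / 2)"
      proof (cases "N n = 0")
        case True
        then show ?thesis using C(1) r by simp
      next
        case False
        then have "0 < N n" unfolding N_def by simp
        then have "ln (N n) \<le> ln (C * (1 + r / 2) ^ n)" using C(2) by (intro ln_mono) auto
        also have "\<dots> = ln C + real n * ln (1 + r / 2)"
          using C(1) r by (subst ln_mult) (auto simp: ln_realpow)
        finally show ?thesis .
      qed
      also have "\<dots> \<le> ln C + real n * (r / 2)"
        using r by (intro add_left_mono mult_left_mono ln_add_one_self_le_self) auto
      also have "ln C < real n * (r / 2)"
      proof -
        have "2 * ln C / r < real n" using n n0 by linarith
        then show ?thesis using r by (simp add: field_simps)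
      qed
      finally have "ln (N n) < r * real n" by (simp add: algebra_simps)
      then show ?thesis using N0 n by (simp add: field_simps)
    qed
    then show "\<exists>no. \<forall>n\<ge>no. norm (ln (N n) / real n - 0) < r"
      by (intro exI[of _ "Suc n0"]) auto
  qed
  then show ?thesis unfolding cover_entropy_def N_def[symmetric] by (rule limI)
qed

theorem corollary5p7:
  fixes K :: "'a topology" and T :: "'a \<Rightarrow> 'a"
  assumes "compact_space K" and "Hausdorff_space K"
    and "homeomorphic_map K K T"
    and "HNS K T"
  shows "topological_entropy K T = 0"
proof -
  have "{topspace K} \<in> Collect (finite_open_cover K)"
    unfolding finite_open_cover_def by simp
  then have "Collect (finite_open_cover K) \<noteq> {}" by blast
  moreover have "ereal (cover_entropy K T \<A>) = 0" if "\<A> \<in> Collect (finite_open_cover K)" for \<A>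
    using HNS_cover_entropy[OF assms] that by (simp add: zero_ereal_def)
  ultimately show ?thesis
    unfolding topological_entropy_def by (simp add: SUP_eq_const)
qed

end
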